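(* Let $r,n\in\mathbb{N}$. Then $$M_n^r=\sum_{k=0}^n c_k M_k,$$ where $(c_0,\dots,c_n)$ is the unique solution of the linear system $$\sum_{k=0}^n\frac{k^{\underline{j}}}{(k+j+1)^{\underline{j}}}\,c_k=\left(\frac{n^{\underline{j}}}{(n+j+1)^{\underline{j}}}\right)^r,\qquad j=0,1,\dots,n.$$
   Context: $\mathbb{N}$ denotes the positive integers. Falling factorials: $z^{\underline{0}}=1$ and $z^{\underline{j}}=z(z-1)\cdots(z-j+1)$ for $j\in\mathbb{N}$. For integers $n\ge 0$ and $0\le k\le n$, let $p_{n,k}(x)=\binom{n}{k}x^k(1-x)^{n-k}$. The Bernstein--Durrmeyer operator $M_n$ (for integers $n\ge 0$) maps $f\in L_1[0,1]$ to the polynomial $$(M_nf)(x)=(n+1)\sum_{k=0}^n p_{n,k}(x)\int_0^1 f(y)\,p_{n,k}(y)\,dy,\quad x\in[0,1].$$ $M_n^r$ denotes the $r$-fold composition (iterate) $M_n\circ\cdots\circ M_n$, and the asserted identity is one of operators on $L_1[0,1]$. *)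

theory Defs
  imports "HOL-Analysis.Analysis"
begin

definition falling_factorial :: "real \<Rightarrow> nat \<Rightarrow> real" where
  "falling_factorial z j = (\<Prod>i<j. z - real i)"

text \<open>
  Elements of \<open>L\<^sub>1[0,1]\<close> are represented by functions that are Lebesgue integrable on \<open>[0,1]\<close>. The
  operator depends only on the almost-everywhere class of its argument on \<open>[0,1]\<close>; its value is
  the polynomial function on all of the real line, of which only the restriction to \<open>[0,1]\<close>
  is of interest. The library's \<open>Bernstein n k\<close> is the basis polynomial \<open>p\<^sub>n\<^sub>,\<^sub>k\<close>.
\<close>

definition Bernstein_Durrmeyer :: "nat \<Rightarrow> (real \<Rightarrow> real) \<Rightarrow> real \<Rightarrow> real" where
  "Bernstein_Durrmeyer n f x =
     (real n + 1) * (\<Sum>k\<le>n. Bernstein n k x * (LINT y:{0..1}|lebesgue. f y * Bernstein n k y))"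

definition coeff_system :: "nat \<Rightarrow> nat \<Rightarrow> (nat \<Rightarrow> real) \<Rightarrow> bool" where
  "coeff_system r n c \<longleftrightarrow>
     (\<forall>j\<le>n. (\<Sum>k\<le>n. falling_factorial (real k) j / falling_factorial (real (k + j + 1)) j * c k)
            = (falling_factorial (real n) j / falling_factorial (real (n + j + 1)) j) ^ r)"

end

theory Submission
  imports Defs
begin

text \<open>
  The operators \<open>M\<^sub>n\<close> are symmetric for the pairing \<open>\<langle>f, g\<rangle> = \<integral>\<^sub>0\<^sup>1 f g\<close>, and they are triangular
  on the monomials: \<open>M\<^sub>n\<close> does not raise the degree of a polynomial, and it multiplies the coefficient
  of \<open>x\<^sup>j\<close> of a polynomial of degree at most \<open>j\<close> by \<open>\<lambda>\<^sub>n\<^sub>,\<^sub>j = n\<^sup>\<underline>j / (n+j+1)\<^sup>\<underline>j\<close>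
  (\<open>symmetric_triangular_Bernstein_Durrmeyer\<close>). Both properties pass to powers and to linear
  combinations. The left-hand side of the asserted identity therefore has the diagonal \<open>\<lambda>\<^sub>n\<^sub>,\<^sub>j\<^sup>r\<close> and
  the right-hand side the diagonal \<open>\<Sum>\<^sub>k c\<^sub>k \<lambda>\<^sub>k\<^sub>,\<^sub>j\<close>. The linear system says that the two agree for
  \<open>j \<le> n\<close>, and for \<open>j > n\<close> both vanish.

  It remains to see that the diagonal determines the operator, that is, that a symmetric triangular
  operator \<open>T\<close> with zero diagonal is zero. Such a \<open>T\<close> lowers degrees. If \<open>T\<close> is known to kill all
  polynomials of degree less than \<open>j\<close> and \<open>p\<close> has degree \<open>j\<close>, then \<open>T (T p) = 0\<close>, so that
  \<open>\<langle>T p, T p\<rangle> = \<langle>p, T (T p)\<rangle> = 0\<close> and \<open>T p = 0\<close>. Hence \<open>T\<close> kills all polynomials. For an arbitrary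
  integrable \<open>f\<close> the image \<open>T f\<close> is a polynomial, and the same computation gives \<open>T f = 0\<close>. This
  replaces the expansion in Legendre polynomials, the common eigenfunctions of the \<open>M\<^sub>n\<close>.

  Finally, \<open>\<lambda>\<^sub>k\<^sub>,\<^sub>j\<close> vanishes for \<open>k < j\<close> and not for \<open>k = j\<close>, so the linear system is triangular and
  has exactly one solution.
\<close>

section \<open>The pairing on the unit interval\<close>

definition unit_pairing :: "(real \<Rightarrow> real) \<Rightarrow> (real \<Rightarrow> real) \<Rightarrow> real" where
  "unit_pairing f g = (LINT y:{0..1}|lebesgue. f y * g y)"

lemma unit_pairing_commute: "unit_pairing f g = unit_pairing g f"
  by (simp add: unit_pairing_def mult.commute)

lemma absolutely_integrable_times_continuous:
  fixes f g :: "real \<Rightarrow> real"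
  assumes "f absolutely_integrable_on {0..1}" "continuous_on {0..1} g"
  shows "(\<lambda>y. f y * g y) absolutely_integrable_on {0..1}"
proof -
  have "g \<in> borel_measurable (lebesgue_on {0..1})"
    using assms(2) by (intro continuous_imp_measurable_on_sets_lebesgue) auto
  moreover have "bounded (g ` {0..1})"
    using assms(2) by (intro compact_imp_bounded compact_continuous_image) auto
  ultimately have "(\<lambda>y. g y * f y) absolutely_integrable_on {0..1}"
    using assms(1) by (intro absolutely_integrable_bounded_measurable_product_real) auto
  then show ?thesis
    by (simp add: mult.commute)
qed

lemma unit_pairing_sum_right:
  assumes "f absolutely_integrable_on {0..1}" "\<And>k. k \<in> A \<Longrightarrow> continuous_on {0..1} (g k)"
  shows "unit_pairing f (\<lambda>y. \<Sum>k\<in>A. c k * g k y) = (\<Sum>k\<in>A. c k * unit_pairing f (g k))"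
proof -
  have int: "integrable lebesgue (\<lambda>y. indicator {0..1} y * (f y * g k y))" if "k \<in> A" for k
    using absolutely_integrable_times_continuous[OF assms(1) assms(2)[OF that]]
    by (simp add: set_integrable_def)
  have "unit_pairing f (\<lambda>y. \<Sum>k\<in>A. c k * g k y) =
      (LINT y|lebesgue. (\<Sum>k\<in>A. c k * (indicator {0..1} y * (f y * g k y))))"
    unfolding unit_pairing_def set_lebesgue_integral_def
    by (rule Bochner_Integration.integral_cong) (auto simp: sum_distrib_left mult_ac)
  also have "\<dots> = (\<Sum>k\<in>A. c k * unit_pairing f (g k))"
    using int by (subst Bochner_Integration.integral_sum)
      (auto simp: unit_pairing_def set_lebesgue_integral_def)
  finally show ?thesis .
qed

lemma absolutely_integrable_poly: "poly p absolutely_integrable_on {0..1::real}"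
  by (intro absolutely_integrable_continuous_real continuous_intros)

lemma continuous_on_poly_real: "continuous_on S (poly (p :: real poly))"
  by (intro continuous_intros)

lemma unit_pairing_poly_self_eq_0:
  assumes "unit_pairing (poly p) (poly p) = 0"
  shows "p = 0"
proof -
  have int: "(\<lambda>y. poly p y * poly p y) absolutely_integrable_on {0..1}"
    by (intro absolutely_integrable_continuous_real continuous_intros)
  have "integral {0..1} (\<lambda>y. poly p y * poly p y) = 0"
    using assms set_lebesgue_integral_eq_integral(2)[OF int] by (simp add: unit_pairing_def)
  moreover have "continuous_on {0..1} (\<lambda>y. poly p y * poly p y)"
    by (intro continuous_intros)
  ultimately have "\<forall>y\<in>{0..1}. poly p y * poly p y = 0"
    by (subst (asm) integral_eq_0_iff) auto
  then have "{0..1} \<subseteq> {y. poly p y = 0}"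
    by auto
  moreover have "infinite {0..1::real}"
    by (simp add: infinite_Icc)
  ultimately show ?thesis
    using poly_roots_finite finite_subset by blast
qed

section \<open>Symmetric triangular operators\<close>

text \<open>
  The parameter \<open>t\<close> is the diagonal of \<open>T\<close> in the monomial basis. The condition \<open>degree p \<le> j\<close>
  instead of \<open>degree p = j\<close> makes the last clause stable under linear combinations and composition,
  where leading coefficients may cancel. The images are polynomial functions on the whole real
  line, so that two operators can be compared as functions, without restriction to the interval.
\<close>

definition symmetric_triangular ::
    "(nat \<Rightarrow> real) \<Rightarrow> ((real \<Rightarrow> real) \<Rightarrow> real \<Rightarrow> real) \<Rightarrow> bool" where
  "symmetric_triangular t T \<longleftrightarrow>
     (\<forall>f. f absolutely_integrable_on {0..1} \<longrightarrow>
        (\<exists>q. T f = poly q) \<and>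
        (\<forall>p. unit_pairing (T f) (poly p) = unit_pairing f (T (poly p)))) \<and>
     (\<forall>p j. degree p \<le> j \<longrightarrow>
        (\<exists>q. T (poly p) = poly q \<and> degree q \<le> j \<and> coeff q j = t j * coeff p j))"

lemma symmetric_triangularI:
  assumes "\<And>f. f absolutely_integrable_on {0..1} \<Longrightarrow> \<exists>q. T f = poly q"
    and "\<And>f p. f absolutely_integrable_on {0..1} \<Longrightarrow>
           unit_pairing (T f) (poly p) = unit_pairing f (T (poly p))"
    and "\<And>p j. degree p \<le> j \<Longrightarrow>
           \<exists>q. T (poly p) = poly q \<and> degree q \<le> j \<and> coeff q j = t j * coeff p j"
  shows "symmetric_triangular t T"
  using assms unfolding symmetric_triangular_def by blast

lemma symmetric_triangular_range:
  assumes "symmetric_triangular t T" "f absolutely_integrable_on {0..1}"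
  obtains q where "T f = poly q"
  using assms unfolding symmetric_triangular_def by blast

lemma symmetric_triangular_symmetric:
  assumes "symmetric_triangular t T" "f absolutely_integrable_on {0..1}"
  shows "unit_pairing (T f) (poly p) = unit_pairing f (T (poly p))"
  using assms unfolding symmetric_triangular_def by blast

lemma symmetric_triangular_poly:
  assumes "symmetric_triangular t T" "degree p \<le> j"
  obtains q where "T (poly p) = poly q" "degree q \<le> j" "coeff q j = t j * coeff p j"
  using assms unfolding symmetric_triangular_def by blast

text \<open>
  The adjoint of a product is the product in the reverse order, so that a product of symmetric
  operators is symmetric only if they commute; the powers of one operator do.
\<close>

lemma symmetric_triangular_funpow:
  assumes T: "symmetric_triangular t T" and "r \<ge> 1"
  shows "symmetric_triangular (\<lambda>j. t j ^ r) (T ^^ r)"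
  using \<open>r \<ge> 1\<close>
proof (induction r rule: dec_induct)
  case base
  then show ?case
    using T by simp
next
  case (step r)
  show ?case
  proof (rule symmetric_triangularI)
    fix f :: "real \<Rightarrow> real"
    assume f: "f absolutely_integrable_on {0..1}"
    obtain q where q: "(T ^^ r) f = poly q"
      using symmetric_triangular_range[OF step.IH f] .
    show "\<exists>q. (T ^^ Suc r) f = poly q"
      using symmetric_triangular_range[OF T absolutely_integrable_poly[of q]] q by auto
    fix p
    obtain q' where q': "T (poly p) = poly q'"
      using symmetric_triangular_range[OF T absolutely_integrable_poly] .
    have "unit_pairing ((T ^^ Suc r) f) (poly p) = unit_pairing ((T ^^ r) f) (T (poly p))"
      using symmetric_triangular_symmetric[OF T absolutely_integrable_poly[of q], of p] q by simp
    also have "\<dots> = unit_pairing f ((T ^^ r) (T (poly p)))"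
      using symmetric_triangular_symmetric[OF step.IH f, of q'] q' by simp
    finally show "unit_pairing ((T ^^ Suc r) f) (poly p) = unit_pairing f ((T ^^ Suc r) (poly p))"
      by (simp add: funpow_swap1)
  next
    fix p :: "real poly" and j :: nat
    assume p: "degree p \<le> j"
    obtain q where q: "(T ^^ r) (poly p) = poly q" "degree q \<le> j" "coeff q j = t j ^ r * coeff p j"
      using symmetric_triangular_poly[OF step.IH p] .
    obtain q' where "T (poly q) = poly q'" "degree q' \<le> j" "coeff q' j = t j * coeff q j"
      using symmetric_triangular_poly[OF T q(2)] .
    then show "\<exists>q. (T ^^ Suc r) (poly p) = poly q \<and> degree q \<le> j \<and>
        coeff q j = t j ^ Suc r * coeff p j"
      using q by auto
  qed
qed

lemma symmetric_triangular_linear_combination: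
  assumes fin: "finite A" and T: "\<And>k. k \<in> A \<Longrightarrow> symmetric_triangular (t k) (T k)"
  shows "symmetric_triangular (\<lambda>j. \<Sum>k\<in>A. c k * t k j) (\<lambda>f x. \<Sum>k\<in>A. c k * T k f x)"
proof (rule symmetric_triangularI)
  fix f :: "real \<Rightarrow> real"
  assume f: "f absolutely_integrable_on {0..1}"
  have "\<forall>k\<in>A. \<exists>q. T k f = poly q"
    using symmetric_triangular_range[OF T f] by metis
  then obtain q where q: "\<And>k. k \<in> A \<Longrightarrow> T k f = poly (q k)"
    by metis
  have "(\<lambda>x. \<Sum>k\<in>A. c k * T k f x) = poly (\<Sum>k\<in>A. smult (c k) (q k))"
    using q by (auto simp: poly_sum intro!: sum.cong)
  then show "\<exists>q. (\<lambda>x. \<Sum>k\<in>A. c k * T k f x) = poly q" ..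
  fix p
  have "continuous_on {0..1} (T k g)" if "k \<in> A" "g absolutely_integrable_on {0..1}" for k g
    using symmetric_triangular_range[OF T[OF that(1)] that(2)] continuous_on_poly_real by metis
  then have cont: "continuous_on {0..1} (T k f)" "continuous_on {0..1} (T k (poly p))"
    if "k \<in> A" for k
    using that f absolutely_integrable_poly by blast+
  have "unit_pairing (\<lambda>x. \<Sum>k\<in>A. c k * T k f x) (poly p) =
      (\<Sum>k\<in>A. c k * unit_pairing (T k f) (poly p))"
    using unit_pairing_sum_right[OF absolutely_integrable_poly cont(1)]
    by (simp add: unit_pairing_commute[of _ "poly p"])
  also have "\<dots> = (\<Sum>k\<in>A. c k * unit_pairing f (T k (poly p)))"
    using symmetric_triangular_symmetric[OF T f] by (auto intro!: sum.cong)
  also have "\<dots> = unit_pairing f (\<lambda>x. \<Sum>k\<in>A. c k * T k (poly p) x)"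
    by (rule unit_pairing_sum_right[OF f cont(2), symmetric])
  finally show "unit_pairing (\<lambda>x. \<Sum>k\<in>A. c k * T k f x) (poly p) =
      unit_pairing f (\<lambda>x. \<Sum>k\<in>A. c k * T k (poly p) x)" .
next
  fix p :: "real poly" and j :: nat
  assume p: "degree p \<le> j"
  have "\<forall>k\<in>A. \<exists>q. T k (poly p) = poly q \<and> degree q \<le> j \<and> coeff q j = t k j * coeff p j"
    using symmetric_triangular_poly[OF T p] by metis
  then obtain q where q: "\<And>k. k \<in> A \<Longrightarrow> T k (poly p) = poly (q k)"
      "\<And>k. k \<in> A \<Longrightarrow> degree (q k) \<le> j" "\<And>k. k \<in> A \<Longrightarrow> coeff (q k) j = t k j * coeff p j"
    by metis
  let ?q = "\<Sum>k\<in>A. smult (c k) (q k)"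
  have "(\<lambda>x. \<Sum>k\<in>A. c k * T k (poly p) x) = poly ?q"
    using q(1) by (auto simp: poly_sum intro!: sum.cong)
  moreover have "degree ?q \<le> j"
    using q(2) fin by (intro degree_sum_le order.trans[OF degree_smult_le]) auto
  moreover have "coeff ?q j = (\<Sum>k\<in>A. c k * t k j) * coeff p j"
    using q(3) by (simp add: coeff_sum sum_distrib_right mult.assoc)
  ultimately show "\<exists>q. (\<lambda>x. \<Sum>k\<in>A. c k * T k (poly p) x) = poly q \<and> degree q \<le> j \<and>
      coeff q j = (\<Sum>k\<in>A. c k * t k j) * coeff p j"
    by blast
qed

text \<open>
  The step from "\<open>T\<close> kills \<open>T f\<close>" to "\<open>T\<close> kills \<open>f\<close>" is the fact that a symmetric operator with
  square zero is zero. It is used for polynomials in an induction on the degree and then once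
  more for integrable functions.
\<close>

lemma symmetric_triangular_zero_diagonal:
  assumes T: "symmetric_triangular (\<lambda>_. 0) T" and f: "f absolutely_integrable_on {0..1}"
  shows "T f = (\<lambda>_. 0)"
proof -
  have square: "T g = (\<lambda>_. 0)"
    if g: "g absolutely_integrable_on {0..1}" and "T (T g) = (\<lambda>_. 0)" for g
  proof -
    obtain q where q: "T g = poly q"
      using symmetric_triangular_range[OF T g] .
    have "unit_pairing (poly q) (poly q) = unit_pairing g (T (T g))"
      using symmetric_triangular_symmetric[OF T g, of q] q by simp
    also have "\<dots> = 0"
      using that(2) by (simp add: unit_pairing_def set_lebesgue_integral_def)
    finally have "q = 0"
      by (rule unit_pairing_poly_self_eq_0)
    then show ?thesis
      using q by auto
  qed
  have kills_poly: "T (poly p) = (\<lambda>_. 0)" for p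
  proof (induction "degree p" arbitrary: p rule: less_induct)
    case less
    obtain q where q: "T (poly p) = poly q" "degree q \<le> degree p" "coeff q (degree p) = 0"
      using symmetric_triangular_poly[OF T order.refl, of p] by auto
    show ?case
    proof (cases "q = 0")
      case True
      then show ?thesis
        using q(1) by auto
    next
      case False
      then have "degree q < degree p"
        using q(2,3) by (metis le_neq_implies_less leading_coeff_0_iff)
      then have "T (T (poly p)) = (\<lambda>_. 0)"
        using less q(1) by simp
      then show ?thesis
        by (rule square[OF absolutely_integrable_poly])
    qed
  qed
  obtain q where "T f = poly q"
    using symmetric_triangular_range[OF T f] .
  then have "T (T f) = (\<lambda>_. 0)"
    using kills_poly by simp
  then show ?thesis
    by (rule square[OF f])
qed

lemma symmetric_triangular_determined_by_diagonal:
  assumes S: "symmetric_triangular t S" and T: "symmetric_triangular t T"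
    and f: "f absolutely_integrable_on {0..1}"
  shows "S f = T f"
proof -
  \<comment> \<open>The difference is written as a linear combination indexed by the truth values.\<close>
  have "symmetric_triangular (\<lambda>j. \<Sum>b\<in>UNIV. (if b then 1 else - 1) * t j)
      (\<lambda>f x. \<Sum>b\<in>UNIV. (if b then 1 else - 1) * (if b then S else T) f x)"
    using S T by (intro symmetric_triangular_linear_combination) auto
  then have "symmetric_triangular (\<lambda>_. 0) (\<lambda>f x. S f x - T f x)"
    by (simp add: UNIV_bool)
  from symmetric_triangular_zero_diagonal[OF this f] show ?thesis
    by (auto simp: fun_eq_iff)
qed

section \<open>Bernstein--Durrmeyer operators are symmetric and triangular\<close>

lemma Bernstein_eq_poly:
  "Bernstein n k = poly (smult (of_nat (n choose k)) (monom 1 k * [:1, -1:] ^ (n - k)))"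
  by (auto simp: Bernstein_def poly_monom)

lemma Bernstein_Durrmeyer_eq:
  "Bernstein_Durrmeyer n f =
     (\<lambda>x. \<Sum>k\<le>n. (real n + 1) * unit_pairing f (Bernstein n k) * Bernstein n k x)"
  by (auto simp: Bernstein_Durrmeyer_def unit_pairing_def sum_distrib_left mult_ac)

lemma Bernstein_Durrmeyer_symmetric:
  assumes f: "f absolutely_integrable_on {0..1}" and g: "g absolutely_integrable_on {0..1}"
  shows "unit_pairing (Bernstein_Durrmeyer n f) g = unit_pairing f (Bernstein_Durrmeyer n g)"
proof -
  have cont: "continuous_on {0..1} (Bernstein n k)" for k
    unfolding Bernstein_eq_poly by (rule continuous_on_poly_real)
  have "unit_pairing g (Bernstein_Durrmeyer n f) =
      (\<Sum>k\<le>n. (real n + 1) * unit_pairing f (Bernstein n k) * unit_pairing g (Bernstein n k))"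
    unfolding Bernstein_Durrmeyer_eq by (rule unit_pairing_sum_right[OF g cont])
  also have "\<dots> = unit_pairing f (Bernstein_Durrmeyer n g)"
    unfolding Bernstein_Durrmeyer_eq by (subst unit_pairing_sum_right[OF f cont]) (simp add: mult_ac)
  finally show ?thesis
    by (simp add: unit_pairing_commute)
qed

text \<open>Euler's beta integral with integer exponents.\<close>

lemma has_integral_power_times_power:
  "((\<lambda>y. y ^ a * (1 - y) ^ b) has_integral fact a * fact b / fact (a + b + 1)) {0..1::real}"
proof -
  have "((\<lambda>y. y powr (real (a + 1) - 1) * (1 - y) powr (real (b + 1) - 1))
      has_integral Beta (real (a + 1)) (real (b + 1))) {0..1}"
    by (rule has_integral_Beta_real) auto
  then have "((\<lambda>y. y ^ a * (1 - y) ^ b) has_integral Beta (real (a + 1)) (real (b + 1))) {0..1}"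
    \<comment> \<open>At the end points \<open>0 powr 0 = 0\<close> differs from \<open>0 ^ 0 = 1\<close>.\<close>
    by (rule has_integral_spike_finite[of "{0, 1}", rotated 2])
      (auto simp: powr_realpow[symmetric])
  also have "Beta (real (a + 1)) (real (b + 1)) = fact a * fact b / fact (a + b + 1)"
    using Gamma_fact[of a, where ?'a = real] Gamma_fact[of b, where ?'a = real]
      Gamma_fact[of "a + b + 1", where ?'a = real]
    by (simp add: Beta_def add_ac)
  finally show ?thesis .
qed

lemma unit_pairing_power_Bernstein:
  assumes "k \<le> n"
  shows "unit_pairing (\<lambda>y. y ^ j) (Bernstein n k) =
     fact n * fact j / fact (n + j + 1) * real ((k + j) choose j)"
proof -
  have int: "(\<lambda>y. y ^ j * Bernstein n k y) absolutely_integrable_on {0..1}"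
    unfolding Bernstein_def by (intro absolutely_integrable_continuous_real continuous_intros)
  have "((\<lambda>y. real (n choose k) * (y ^ (k + j) * (1 - y) ^ (n - k))) has_integral
      real (n choose k) * (fact (k + j) * fact (n - k) / fact (k + j + (n - k) + 1))) {0..1}"
    by (intro has_integral_mult_right has_integral_power_times_power)
  then have "((\<lambda>y. y ^ j * Bernstein n k y) has_integral
      real (n choose k) * (fact (k + j) * fact (n - k) / fact (n + j + 1))) {0..1}"
    using assms by (simp add: Bernstein_def power_add mult_ac add_ac)
  then have "unit_pairing (\<lambda>y. y ^ j) (Bernstein n k) =
      real (n choose k) * (fact (k + j) * fact (n - k) / fact (n + j + 1))"
    unfolding unit_pairing_def set_lebesgue_integral_eq_integral(2)[OF int]
    by (rule integral_unique)
  also have "\<dots> = fact n * fact j / fact (n + j + 1) * real ((k + j) choose j)"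
    using assms by (simp add: binomial_fact field_simps del: fact_Suc)
  finally show ?thesis .
qed

text \<open>Factorial moments of the binomial distribution, divided by \<open>i!\<close>.\<close>

lemma sum_choose_Bernstein:
  "(\<Sum>k\<le>n. real (k choose i) * Bernstein n k x) = real (n choose i) * x ^ i"
proof (cases "i \<le> n")
  case False
  then show ?thesis
    by (simp add: binomial_eq_0)
next
  case True
  have "(\<Sum>k\<le>n. real (k choose i) * Bernstein n k x) =
      (\<Sum>k\<in>{i..n}. real (k choose i) * Bernstein n k x)"
    by (rule sum.mono_neutral_right) (auto simp: binomial_eq_0)
  also have "\<dots> = (\<Sum>k\<in>{i..n}. real (n choose i) * x ^ i * Bernstein (n - i) (k - i) x)"
  proof (rule sum.cong)
    fix k assume k: "k \<in> {i..n}"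
    have "real (n choose k) * real (k choose i) = real (n choose i) * real ((n - i) choose (k - i))"
      using choose_mult[of i k n] k by (metis atLeastAtMost_iff of_nat_mult)
    moreover have "x ^ k = x ^ i * x ^ (k - i)"
      using k by (simp flip: power_add)
    ultimately show "real (k choose i) * Bernstein n k x =
        real (n choose i) * x ^ i * Bernstein (n - i) (k - i) x"
      using k by (auto simp: Bernstein_def mult.commute)
  qed auto
  also have "\<dots> = real (n choose i) * x ^ i * (\<Sum>m\<le>n - i. Bernstein (n - i) m x)"
    unfolding sum_distrib_left
    by (rule sum.reindex_bij_witness[where i = "\<lambda>m. m + i" and j = "\<lambda>k. k - i"]) (use True in auto)
  finally show ?thesis
    by simp
qed

definition durrmeyer_monomial :: "nat \<Rightarrow> nat \<Rightarrow> real poly" where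
  "durrmeyer_monomial n j =
     (\<Sum>i\<le>j. monom (fact (n + 1) * fact j / fact (n + j + 1) *
                     (real (j choose i) * real (n choose i))) i)"

text \<open>
  The pairings of \<open>y\<^sup>j\<close> with the Bernstein basis are multiples of \<open>k+j\<close> choose \<open>j\<close>. Vandermonde's
  identity expands these in the binomial coefficients \<open>k\<close> choose \<open>i\<close> with \<open>i \<le> j\<close>, whose Bernstein
  sums are monomials of degree \<open>i\<close>.
\<close>

lemma Bernstein_Durrmeyer_power:
  "Bernstein_Durrmeyer n (\<lambda>y. y ^ j) = poly (durrmeyer_monomial n j)"
proof
  fix x :: real
  define C :: real where "C = fact (n + 1) * fact j / fact (n + j + 1)"
  have vandermonde': "real ((k + j) choose j) = (\<Sum>i\<le>j. real (j choose i) * real (k choose i))" for k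
  proof -
    have "(k + j) choose j = (\<Sum>i\<le>j. (k choose i) * (j choose (j - i)))"
      by (rule vandermonde[symmetric])
    also have "\<dots> = (\<Sum>i\<le>j. (j choose i) * (k choose i))"
      by (rule sum.cong) (auto simp: binomial_symmetric[symmetric])
    finally show ?thesis
      by simp
  qed
  have "Bernstein_Durrmeyer n (\<lambda>y. y ^ j) x =
      (\<Sum>k\<le>n. C * (real ((k + j) choose j) * Bernstein n k x))"
    unfolding Bernstein_Durrmeyer_eq
    by (rule sum.cong) (auto simp: unit_pairing_power_Bernstein C_def)
  also have "\<dots> = (\<Sum>k\<le>n. \<Sum>i\<le>j. C * real (j choose i) * (real (k choose i) * Bernstein n k x))"
    by (simp add: vandermonde' sum_distrib_left sum_distrib_right mult_ac)
  also have "\<dots> = (\<Sum>i\<le>j. C * real (j choose i) * (\<Sum>k\<le>n. real (k choose i) * Bernstein n k x))"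
    by (subst sum.swap) (simp add: sum_distrib_left)
  also have "\<dots> = poly (durrmeyer_monomial n j) x"
    by (simp add: sum_choose_Bernstein durrmeyer_monomial_def poly_sum poly_monom C_def mult_ac)
  finally show "Bernstein_Durrmeyer n (\<lambda>y. y ^ j) x = poly (durrmeyer_monomial n j) x" .
qed

definition durrmeyer_eigenvalue :: "nat \<Rightarrow> nat \<Rightarrow> real" where
  "durrmeyer_eigenvalue n j =
     falling_factorial (real n) j / falling_factorial (real (n + j + 1)) j"

lemma falling_factorial_of_nat: "falling_factorial (real n) j = fact j * real (n choose j)"
  by (simp add: falling_factorial_def binomial_gbinomial gbinomial_mult_fact atLeast0LessThan)

lemma durrmeyer_eigenvalue_eq:
  "durrmeyer_eigenvalue n j = fact (n + 1) * fact j / fact (n + j + 1) * real (n choose j)"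
proof -
  have "real ((n + j + 1) choose j) = fact (n + j + 1) / (fact j * fact (n + 1))"
    using binomial_fact[of j "n + j + 1", where ?'a = real] by (simp add: add_ac)
  then show ?thesis
    unfolding durrmeyer_eigenvalue_def falling_factorial_of_nat by (simp del: fact_Suc)
qed

lemma durrmeyer_eigenvalue_eq_0_iff: "durrmeyer_eigenvalue n j = 0 \<longleftrightarrow> n < j"
  by (simp add: durrmeyer_eigenvalue_eq del: fact_Suc)

lemma degree_durrmeyer_monomial: "degree (durrmeyer_monomial n j) \<le> j"
  unfolding durrmeyer_monomial_def
  by (intro degree_sum_le order.trans[OF degree_monom_le]) auto

lemma coeff_durrmeyer_monomial: "coeff (durrmeyer_monomial n j) j = durrmeyer_eigenvalue n j"
  by (simp add: durrmeyer_monomial_def coeff_sum durrmeyer_eigenvalue_eq)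

lemma Bernstein_Durrmeyer_poly:
  assumes "degree p \<le> j"
  shows "Bernstein_Durrmeyer n (poly p) = poly (\<Sum>i\<le>j. smult (coeff p i) (durrmeyer_monomial n i))"
proof
  fix x :: real
  have cont: "continuous_on {0..1} (\<lambda>y::real. y ^ i)" for i
    by (intro continuous_intros)
  have Bernstein: "Bernstein n k absolutely_integrable_on {0..1}" for k
    unfolding Bernstein_eq_poly by (rule absolutely_integrable_poly)
  have p: "poly p = (\<lambda>y. \<Sum>i\<le>j. coeff p i * y ^ i)"
    unfolding fun_eq_iff poly_altdef
    using assms by (intro allI sum.mono_neutral_left) (auto simp: coeff_eq_0)
  have "unit_pairing (poly p) (Bernstein n k) =
      (\<Sum>i\<le>j. coeff p i * unit_pairing (\<lambda>y. y ^ i) (Bernstein n k))" for k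
    unfolding unit_pairing_commute[of _ "Bernstein n k"] p
    by (rule unit_pairing_sum_right[OF Bernstein cont])
  then have "Bernstein_Durrmeyer n (poly p) x =
      (\<Sum>k\<le>n. \<Sum>i\<le>j. coeff p i *
        ((real n + 1) * unit_pairing (\<lambda>y. y ^ i) (Bernstein n k) * Bernstein n k x))"
    by (simp add: Bernstein_Durrmeyer_eq sum_distrib_left sum_distrib_right mult_ac)
  also have "\<dots> = (\<Sum>i\<le>j. coeff p i * Bernstein_Durrmeyer n (\<lambda>y. y ^ i) x)"
    by (subst sum.swap) (simp add: Bernstein_Durrmeyer_eq sum_distrib_left)
  finally show "Bernstein_Durrmeyer n (poly p) x =
      poly (\<Sum>i\<le>j. smult (coeff p i) (durrmeyer_monomial n i)) x"
    by (simp add: Bernstein_Durrmeyer_power poly_sum)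
qed

lemma symmetric_triangular_Bernstein_Durrmeyer:
  "symmetric_triangular (durrmeyer_eigenvalue n) (Bernstein_Durrmeyer n)"
proof (rule symmetric_triangularI)
  fix f :: "real \<Rightarrow> real"
  assume f: "f absolutely_integrable_on {0..1}"
  have "Bernstein_Durrmeyer n f = poly (\<Sum>k\<le>n. smult ((real n + 1) * unit_pairing f (Bernstein n k))
      (smult (of_nat (n choose k)) (monom 1 k * [:1, -1:] ^ (n - k))))"
    unfolding Bernstein_Durrmeyer_eq by (simp add: poly_sum poly_monom Bernstein_def fun_eq_iff mult_ac)
  then show "\<exists>q. Bernstein_Durrmeyer n f = poly q" ..
  show "unit_pairing (Bernstein_Durrmeyer n f) (poly p) =
      unit_pairing f (Bernstein_Durrmeyer n (poly p))" for p
    by (rule Bernstein_Durrmeyer_symmetric[OF f absolutely_integrable_poly])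
next
  fix p :: "real poly" and j :: nat
  assume p: "degree p \<le> j"
  let ?q = "\<Sum>i\<le>j. smult (coeff p i) (durrmeyer_monomial n i)"
  have deg: "degree (durrmeyer_monomial n i) \<le> i" for i
    by (rule degree_durrmeyer_monomial)
  have "degree ?q \<le> j"
    using deg by (intro degree_sum_le order.trans[OF degree_smult_le]) (auto intro: order.trans)
  moreover have "coeff ?q j = durrmeyer_eigenvalue n j * coeff p j"
  proof -
    have "coeff ?q j = (\<Sum>i\<le>j. coeff p i * coeff (durrmeyer_monomial n i) j)"
      by (simp add: coeff_sum)
    also have "\<dots> = (\<Sum>i\<le>j. if i = j then coeff p j * durrmeyer_eigenvalue n j else 0)"
    proof (rule sum.cong)
      fix i assume "i \<in> {..j}"
      then show "coeff p i * coeff (durrmeyer_monomial n i) j =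
          (if i = j then coeff p j * durrmeyer_eigenvalue n j else 0)"
        using deg[of i] by (auto simp: coeff_durrmeyer_monomial intro!: coeff_eq_0)
    qed auto
    finally show ?thesis
      by simp
  qed
  ultimately show "\<exists>q. Bernstein_Durrmeyer n (poly p) = poly q \<and> degree q \<le> j \<and>
      coeff q j = durrmeyer_eigenvalue n j * coeff p j"
    using Bernstein_Durrmeyer_poly[OF p] by blast
qed

section \<open>Triangular linear systems\<close>

text \<open>
  The last equation determines the last unknown, and its contribution moves to the right-hand
  side of the remaining equations.
\<close>

lemma upper_triangular_system_unique_solution:
  fixes a :: "nat \<Rightarrow> nat \<Rightarrow> real"
  assumes zero: "\<And>j k. k < j \<Longrightarrow> a j k = 0" and diag: "\<And>j. a j j \<noteq> 0"
  shows "\<exists>!c. c \<in> {..<m} \<rightarrow>\<^sub>E UNIV \<and> (\<forall>j<m. (\<Sum>k<m. a j k * c k) = b j)"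
proof (induction m arbitrary: b)
  case 0
  then show ?case
    by simp
next
  case (Suc m)
  define y where "y = b m / a m m"
  let ?solves = "\<lambda>d. d \<in> {..<m} \<rightarrow>\<^sub>E UNIV \<and> (\<forall>j<m. (\<Sum>k<m. a j k * d k) = b j - a j m * y)"
  have "\<exists>!d. ?solves d"
    by (rule Suc.IH)
  then obtain d where d: "?solves d" and unique: "\<And>d'. ?solves d' \<Longrightarrow> d' = d"
    by (elim ex1E) blast
  have last: "(\<Sum>k<m. a m k * c k) = 0" for c
    using zero by simp
  show ?case
  proof (rule ex1I[of _ "d(m := y)"], intro conjI allI impI)
    show "d(m := y) \<in> {..<Suc m} \<rightarrow>\<^sub>E UNIV"
      using d by (auto simp: PiE_def extensional_def)
    fix j assume j: "j < Suc m"
    have "(\<Sum>k<m. a j k * (d(m := y)) k) = (\<Sum>k<m. a j k * d k)"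
      by (rule sum.cong) auto
    then have sum: "(\<Sum>k<Suc m. a j k * (d(m := y)) k) = (\<Sum>k<m. a j k * d k) + a j m * y"
      by simp
    show "(\<Sum>k<Suc m. a j k * (d(m := y)) k) = b j"
    proof (cases "j = m")
      case True
      then show ?thesis
        unfolding sum using last diag by (simp add: y_def)
    next
      case False
      then have "(\<Sum>k<m. a j k * d k) = b j - a j m * y"
        using d j by simp
      then show ?thesis
        unfolding sum by simp
    qed
  next
    fix c
    assume c: "c \<in> {..<Suc m} \<rightarrow>\<^sub>E UNIV \<and> (\<forall>j<Suc m. (\<Sum>k<Suc m. a j k * c k) = b j)"
    then have eq: "(\<Sum>k<m. a j k * c k) + a j m * c m = b j" if "j < Suc m" for j
      using that by simp
    have cm: "c m = y"
      using eq[of m] last[of c] diag[of m] by (simp add: y_def field_simps)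
    have "(\<Sum>k<m. a j k * (c(m := undefined)) k) = (\<Sum>k<m. a j k * c k)" for j
      by (rule sum.cong) auto
    moreover have "(\<Sum>k<m. a j k * c k) = b j - a j m * y" if "j < m" for j
      using eq[of j] that cm by simp
    moreover have "c(m := undefined) \<in> {..<m} \<rightarrow>\<^sub>E UNIV"
      using c by (auto simp: PiE_def extensional_def)
    ultimately have "c(m := undefined) = d"
      by (intro unique) simp
    then show "c = d(m := y)"
      using cm by auto
  qed
qed

section \<open>Iterates as linear combinations\<close>

lemma coeff_system_iff:
  "coeff_system r n c \<longleftrightarrow>
     (\<forall>j\<le>n. (\<Sum>k\<le>n. durrmeyer_eigenvalue k j * c k) = durrmeyer_eigenvalue n j ^ r)"
  by (simp add: coeff_system_def durrmeyer_eigenvalue_def)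

lemma Bernstein_Durrmeyer_funpow:
  assumes "r \<ge> 1" and c: "coeff_system r n c" and f: "f absolutely_integrable_on {0..1}"
  shows "(Bernstein_Durrmeyer n ^^ r) f = (\<lambda>x. \<Sum>k\<le>n. c k * Bernstein_Durrmeyer k f x)"
proof (rule symmetric_triangular_determined_by_diagonal[OF _ _ f])
  show "symmetric_triangular (\<lambda>j. durrmeyer_eigenvalue n j ^ r) (Bernstein_Durrmeyer n ^^ r)"
    using symmetric_triangular_Bernstein_Durrmeyer \<open>r \<ge> 1\<close> by (rule symmetric_triangular_funpow)
  have "(\<Sum>k\<le>n. c k * durrmeyer_eigenvalue k j) = durrmeyer_eigenvalue n j ^ r" for j
  proof (cases "j \<le> n")
    case True
    then show ?thesis
      using c by (simp add: coeff_system_iff mult.commute)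
  next
    case False
    then have "durrmeyer_eigenvalue k j = 0" if "k \<le> n" for k
      using that by (simp add: durrmeyer_eigenvalue_eq_0_iff)
    then show ?thesis
      using \<open>r \<ge> 1\<close> by (simp add: power_0_left)
  qed
  moreover have "symmetric_triangular (\<lambda>j. \<Sum>k\<le>n. c k * durrmeyer_eigenvalue k j)
      (\<lambda>f x. \<Sum>k\<le>n. c k * Bernstein_Durrmeyer k f x)"
    by (intro symmetric_triangular_linear_combination symmetric_triangular_Bernstein_Durrmeyer) auto
  ultimately show "symmetric_triangular (\<lambda>j. durrmeyer_eigenvalue n j ^ r)
      (\<lambda>f x. \<Sum>k\<le>n. c k * Bernstein_Durrmeyer k f x)"
    by simp
qed

theorem corollary8:
  fixes r n :: nat
  assumes "r \<ge> 1" and "n \<ge> 1"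
  shows "(\<exists>!c. c \<in> {..n} \<rightarrow>\<^sub>E UNIV \<and> coeff_system r n c) \<and>
         (\<forall>c. coeff_system r n c \<longrightarrow>
            (\<forall>f. f absolutely_integrable_on {0..1} \<longrightarrow>
               (\<forall>x\<in>{0..1}. (Bernstein_Durrmeyer n ^^ r) f x
                          = (\<Sum>k\<le>n. c k * Bernstein_Durrmeyer k f x))))"
proof (intro conjI allI impI ballI)
  have "\<exists>!c. c \<in> {..<Suc n} \<rightarrow>\<^sub>E UNIV \<and>
      (\<forall>j<Suc n. (\<Sum>k<Suc n. durrmeyer_eigenvalue k j * c k) = durrmeyer_eigenvalue n j ^ r)"
    by (rule upper_triangular_system_unique_solution) (auto simp: durrmeyer_eigenvalue_eq_0_iff)
  then show "\<exists>!c. c \<in> {..n} \<rightarrow>\<^sub>E UNIV \<and> coeff_system r n c"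
    by (simp add: coeff_system_iff lessThan_Suc_atMost less_Suc_eq_le del: sum.lessThan_Suc)
next
  fix c and f :: "real \<Rightarrow> real" and x :: real
  assume "coeff_system r n c" "f absolutely_integrable_on {0..1}"
  then show "(Bernstein_Durrmeyer n ^^ r) f x = (\<Sum>k\<le>n. c k * Bernstein_Durrmeyer k f x)"
    using Bernstein_Durrmeyer_funpow[OF \<open>r \<ge> 1\<close>] by simp
qed

end
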